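(* There is no tame triangulation of $G(3,\mathbb{R}^\infty)$.
   Context: Identify $\mathbb{R}^n$ with a subspace of $\mathbb{R}^{n+1}$ (by appending a zero coordinate) and let $\mathbb{R}^\infty=\bigcup_n \mathbb{R}^n$ be the union (colimit), with standard basis $e_1,e_2,\dots$ and standard inner product $v\cdot w$. $G(k,\mathbb{R}^n)$ is the Grassmannian of $k$-dimensional linear subspaces of $\mathbb{R}^n$ with its usual topology, and $G(k,\mathbb{R}^\infty)=\bigcup_n G(k,\mathbb{R}^n)$ is the Grassmannian of $k$-dimensional linear subspaces of $\mathbb{R}^\infty$, with the colimit topology. A triangulation of a space $X$ is a homeomorphism from the geometric realization of a simplicial complex onto $X$; we identify simplices with their images in $X$, and $\operatorname{int}\sigma$ denotes the (relative) interior of a simplex $\sigma$. A triangulation of $G(k,\mathbb{R}^\infty)$ is *tame* if for every simplex $\sigma$, for every pair of $k$-planes $V,W\in\operatorname{int}\sigma$, and for every vector $v\in V$, there is a vector $w\in W$ such that for all standard basis vectors $e_i$, $v\cdot e_i=0 \Leftrightarrow w\cdot e_i=0$. *)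

theory Defs
  imports "HOL-Analysis.Analysis" "HOL-Analysis.Finite_Function_Topology"
begin

section \<open>Quotient and coherent (colimit) topologies\<close>

definition quotient_top :: "'a topology \<Rightarrow> ('a \<Rightarrow> 'b) \<Rightarrow> 'b topology" where
  "quotient_top X f =
     topology (\<lambda>U. U \<subseteq> f ` topspace X \<and> openin X {x \<in> topspace X. f x \<in> U})"

lemma openin_quotient_top:
  "openin (quotient_top X f) U \<longleftrightarrow>
     U \<subseteq> f ` topspace X \<and> openin X {x \<in> topspace X. f x \<in> U}"
proof -
  have "istopology (\<lambda>U. U \<subseteq> f ` topspace X \<and> openin X {x \<in> topspace X. f x \<in> U})"
    unfolding istopology_def
  proof (intro conjI allI impI)
    fix S T
    assume S: "S \<subseteq> f ` topspace X \<and> openin X {x \<in> topspace X. f x \<in> S}"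
      and T: "T \<subseteq> f ` topspace X \<and> openin X {x \<in> topspace X. f x \<in> T}"
    show "S \<inter> T \<subseteq> f ` topspace X" using S by blast
    have "{x \<in> topspace X. f x \<in> S \<inter> T}
        = {x \<in> topspace X. f x \<in> S} \<inter> {x \<in> topspace X. f x \<in> T}" by blast
    then show "openin X {x \<in> topspace X. f x \<in> S \<inter> T}"
      using openin_Int[of X "{x \<in> topspace X. f x \<in> S}" "{x \<in> topspace X. f x \<in> T}"] S T by simp
  next
    fix \<K>
    assume K: "\<forall>K\<in>\<K>. K \<subseteq> f ` topspace X \<and> openin X {x \<in> topspace X. f x \<in> K}"
    show "\<Union>\<K> \<subseteq> f ` topspace X" using K by blast
    have "{x \<in> topspace X. f x \<in> \<Union>\<K>} = (\<Union>K\<in>\<K>. {x \<in> topspace X. f x \<in> K})" by blast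
    then show "openin X {x \<in> topspace X. f x \<in> \<Union>\<K>}"
      using K by (auto intro: openin_Union)
  qed
  then show ?thesis by (simp add: quotient_top_def topology_inverse')
qed

lemma topspace_quotient_top [simp]: "topspace (quotient_top X f) = f ` topspace X"
proof
  show "topspace (quotient_top X f) \<subseteq> f ` topspace X"
    using openin_quotient_top[of X f "topspace (quotient_top X f)"] by simp
  have "{x \<in> topspace X. f x \<in> f ` topspace X} = topspace X" by blast
  then have "openin (quotient_top X f) (f ` topspace X)"
    by (simp add: openin_quotient_top)
  then show "f ` topspace X \<subseteq> topspace (quotient_top X f)"
    by (rule openin_subset)
qed

lemma quotient_map_quotient_top: "quotient_map X (quotient_top X f) f"
  by (simp add: quotient_map_def openin_quotient_top)

definition coherent_top :: "'i set \<Rightarrow> ('i \<Rightarrow> 'a topology) \<Rightarrow> 'a topology" where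
  "coherent_top I X =
     topology (\<lambda>U. U \<subseteq> (\<Union>i\<in>I. topspace (X i)) \<and>
                   (\<forall>i\<in>I. openin (X i) (U \<inter> topspace (X i))))"

lemma openin_coherent_top:
  "openin (coherent_top I X) U \<longleftrightarrow>
     U \<subseteq> (\<Union>i\<in>I. topspace (X i)) \<and> (\<forall>i\<in>I. openin (X i) (U \<inter> topspace (X i)))"
proof -
  have "istopology (\<lambda>U. U \<subseteq> (\<Union>i\<in>I. topspace (X i)) \<and>
                   (\<forall>i\<in>I. openin (X i) (U \<inter> topspace (X i))))"
    unfolding istopology_def
  proof (intro conjI allI impI ballI)
    fix S T i
    assume S: "S \<subseteq> (\<Union>i\<in>I. topspace (X i)) \<and> (\<forall>i\<in>I. openin (X i) (S \<inter> topspace (X i)))"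
      and T: "T \<subseteq> (\<Union>i\<in>I. topspace (X i)) \<and> (\<forall>i\<in>I. openin (X i) (T \<inter> topspace (X i)))"
    show "S \<inter> T \<subseteq> (\<Union>i\<in>I. topspace (X i))" using S by blast
    assume "i \<in> I"
    moreover have "S \<inter> T \<inter> topspace (X i) = (S \<inter> topspace (X i)) \<inter> (T \<inter> topspace (X i))"
      by blast
    ultimately show "openin (X i) (S \<inter> T \<inter> topspace (X i))"
      using openin_Int[of "X i" "S \<inter> topspace (X i)" "T \<inter> topspace (X i)"] S T by simp
  next
    fix \<K>
    assume K: "\<forall>K\<in>\<K>. K \<subseteq> (\<Union>i\<in>I. topspace (X i)) \<and>
                      (\<forall>i\<in>I. openin (X i) (K \<inter> topspace (X i)))"
    show "\<Union>\<K> \<subseteq> (\<Union>i\<in>I. topspace (X i))" using K by blast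
    fix i assume "i \<in> I"
    moreover have "\<Union>\<K> \<inter> topspace (X i) = (\<Union>K\<in>\<K>. K \<inter> topspace (X i))" by blast
    moreover have "openin (X i) (\<Union>K\<in>\<K>. K \<inter> topspace (X i))"
      using K \<open>i \<in> I\<close> by (intro openin_Union) blast
    ultimately show "openin (X i) (\<Union>\<K> \<inter> topspace (X i))" by (simp only:)
  qed
  then show ?thesis by (simp add: coherent_top_def topology_inverse')
qed

lemma topspace_coherent_top_subset:
  "topspace (coherent_top I X) \<subseteq> (\<Union>i\<in>I. topspace (X i))"
  using openin_coherent_top[of I X "topspace (coherent_top I X)"] by simp

lemma topspace_coherent_top [simp]:
  "topspace (coherent_top I X) = (\<Union>i\<in>I. topspace (X i))"
proof
  have "(\<Union>i\<in>I. topspace (X i)) \<inter> topspace (X j) = topspace (X j)" if "j \<in> I" for j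
    using that by blast
  then have "openin (coherent_top I X) (\<Union>i\<in>I. topspace (X i))"
    by (simp add: openin_coherent_top)
  then show "(\<Union>i\<in>I. topspace (X i)) \<subseteq> topspace (coherent_top I X)"
    by (rule openin_subset)
qed (rule topspace_coherent_top_subset)


section \<open>The space of finitely supported real sequences\<close>

text \<open>The standard basis is indexed from 0.  The library norm on this type is the
  $\ell^1$ norm, so the standard inner product is not available as a type-class instance;
  on each finite-dimensional subspace the norm topology is the usual one.\<close>

type_synonym rinf = "nat \<Rightarrow>\<^sub>0 real"

definition rn :: "nat \<Rightarrow> rinf set" where
  "rn n = {v. Poly_Mapping.keys v \<subseteq> {..<n}}"

definition std_basis :: "nat \<Rightarrow> rinf" where
  "std_basis i = Poly_Mapping.single i 1"

definition rinf_inner :: "rinf \<Rightarrow> rinf \<Rightarrow> real" where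
  "rinf_inner v w =
     (\<Sum>i\<in>Poly_Mapping.keys v. Poly_Mapping.lookup v i * Poly_Mapping.lookup w i)"

lemma rinf_inner_std_basis [simp]:
  "rinf_inner v (std_basis i) = Poly_Mapping.lookup v i"
proof -
  have "rinf_inner v (std_basis i)
      = (\<Sum>j\<in>Poly_Mapping.keys v. if j = i then Poly_Mapping.lookup v j else 0)"
    unfolding rinf_inner_def std_basis_def
    by (rule sum.cong) (auto simp: lookup_single when_def)
  then show ?thesis by (simp add: in_keys_iff)
qed


section \<open>Grassmannians\<close>

definition grass :: "nat \<Rightarrow> nat \<Rightarrow> rinf set set" where
  "grass k n = {V. subspace V \<and> V \<subseteq> rn n \<and> dim V = k}"

definition frames :: "nat \<Rightarrow> nat \<Rightarrow> (nat \<Rightarrow> rinf) set" where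
  "frames k n = {f \<in> {..<k} \<rightarrow>\<^sub>E rn n. inj_on f {..<k} \<and> independent (f ` {..<k})}"

definition frames_top :: "nat \<Rightarrow> nat \<Rightarrow> (nat \<Rightarrow> rinf) topology" where
  "frames_top k n =
     subtopology (product_topology (\<lambda>i. top_of_set (rn n)) {..<k}) (frames k n)"

text \<open>The usual topology: the quotient of the Stiefel manifold of (not necessarily
  orthonormal) frames under the map sending a frame to its span.\<close>

definition grass_top :: "nat \<Rightarrow> nat \<Rightarrow> rinf set topology" where
  "grass_top k n = quotient_top (frames_top k n) (\<lambda>f. span (f ` {..<k}))"

definition grass_inf :: "nat \<Rightarrow> rinf set set" where
  "grass_inf k = (\<Union>n. grass k n)"

definition grass_inf_top :: "nat \<Rightarrow> rinf set topology" where
  "grass_inf_top k = coherent_top UNIV (grass_top k)"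

lemma subspace_rn: "subspace (rn n)"
proof -
  have "Poly_Mapping.keys (c *\<^sub>R v) \<subseteq> Poly_Mapping.keys v" for c and v :: rinf
    by (auto simp: scaleR_poly_mapping_def in_keys_iff)
  moreover have "Poly_Mapping.keys (v + w) \<subseteq> Poly_Mapping.keys v \<union> Poly_Mapping.keys w"
    for v w :: rinf
    by (auto simp: in_keys_iff lookup_add)
  ultimately show ?thesis
    unfolding subspace_def rn_def by fastforce
qed

lemma rinf_sum_std_basis:
  fixes v :: rinf
  shows "v = (\<Sum>i\<in>Poly_Mapping.keys v. Poly_Mapping.lookup v i *\<^sub>R std_basis i)"
proof (rule poly_mapping_eqI)
  have [simp]: "Poly_Mapping.lookup (c *\<^sub>R w) j = c * Poly_Mapping.lookup w j"
    for c j and w :: rinf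
  proof -
    have "finite {i. c * Poly_Mapping.lookup w i \<noteq> 0}"
      by (rule finite_subset[of _ "Poly_Mapping.keys w"]) (auto simp: in_keys_iff)
    then show ?thesis
      by (simp add: scaleR_poly_mapping_def)
  qed
  fix j
  show "Poly_Mapping.lookup v j =
    Poly_Mapping.lookup (\<Sum>i\<in>Poly_Mapping.keys v. Poly_Mapping.lookup v i *\<^sub>R std_basis i) j"
    by (simp add: lookup_sum std_basis_def lookup_single when_def in_keys_iff
        if_distrib[of "\<lambda>x. _ * x"] cong: if_cong)
qed

lemma rn_eq_span: "rn n = span (std_basis ` {..<n})"
proof
  show "rn n \<subseteq> span (std_basis ` {..<n})"
  proof
    fix v assume "v \<in> rn n"
    then have "(\<Sum>i\<in>Poly_Mapping.keys v. Poly_Mapping.lookup v i *\<^sub>R std_basis i)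
        \<in> span (std_basis ` {..<n})"
      by (intro span_sum span_scale span_base) (auto simp: rn_def)
    then show "v \<in> span (std_basis ` {..<n})"
      by (subst rinf_sum_std_basis[of v])
  qed
  show "span (std_basis ` {..<n}) \<subseteq> rn n"
    by (rule span_minimal[OF _ subspace_rn]) (auto simp: rn_def std_basis_def)
qed

lemma topspace_frames_top: "topspace (frames_top k n) = frames k n"
  by (auto simp: frames_top_def frames_def)

lemma topspace_grass_top [simp]: "topspace (grass_top k n) = grass k n"
proof -
  have "(\<lambda>f. span (f ` {..<k})) ` frames k n = grass k n"
  proof (intro equalityI subsetI)
    fix V assume "V \<in> (\<lambda>f. span (f ` {..<k})) ` frames k n"
    then obtain f where f: "f \<in> {..<k} \<rightarrow>\<^sub>E rn n" "inj_on f {..<k}"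
      "independent (f ` {..<k})" and V: "V = span (f ` {..<k})"
      by (auto simp: frames_def)
    have "V \<subseteq> rn n"
      unfolding V by (rule span_minimal[OF _ subspace_rn]) (use f(1) in auto)
    moreover have "dim V = k"
      using dim_eq_card_independent[OF f(3)] card_image[OF f(2)] by (simp add: V)
    ultimately show "V \<in> grass k n" by (simp add: grass_def V)
  next
    fix V assume "V \<in> grass k n"
    then have V: "subspace V" "V \<subseteq> rn n" "dim V = k" by (auto simp: grass_def)
    obtain B where B: "B \<subseteq> V" "independent B" "V \<subseteq> span B" "card B = dim V"
      using basis_exists by blast
    have "finite B"
      using independent_span_bound[of "std_basis ` {..<n}" B] B(1,2) V(2) rn_eq_span by auto
    then obtain g where g: "bij_betw g {..<k} B"
      using ex_bij_betw_nat_finite[of B] B(4) V(3) by (auto simp: lessThan_atLeast0)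
    define f where "f = restrict g {..<k}"
    have im: "f ` {..<k} = B" and inj: "inj_on f {..<k}"
      using g by (auto simp: f_def bij_betw_def inj_on_def)
    have "f \<in> frames k n"
      using im inj B(1,2) V(2) by (auto simp: frames_def f_def PiE_def)
    moreover have "span (f ` {..<k}) = V"
      using im B(1,3) V(1) span_minimal by blast
    ultimately show "V \<in> (\<lambda>f. span (f ` {..<k})) ` frames k n" by blast
  qed
  then show ?thesis by (simp add: grass_top_def topspace_frames_top)
qed

lemma topspace_grass_inf_top [simp]: "topspace (grass_inf_top k) = grass_inf k"
  by (simp add: grass_inf_top_def grass_inf_def)


section \<open>Simplicial complexes and triangulations\<close>

text \<open>Complexes are abstract and may be infinite (and not locally finite); the geometric
  realization consists of barycentric coordinate functions and carries the weak topology
  determined by its closed simplices.\<close>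

definition abs_simplicial_complex :: "'v set set \<Rightarrow> bool" where
  "abs_simplicial_complex K \<longleftrightarrow>
     (\<forall>\<sigma>\<in>K. finite \<sigma> \<and> \<sigma> \<noteq> {}) \<and>
     (\<forall>\<sigma>\<in>K. \<forall>\<tau>. \<tau> \<subseteq> \<sigma> \<and> \<tau> \<noteq> {} \<longrightarrow> \<tau> \<in> K)"

definition closed_simplex :: "'v set \<Rightarrow> ('v \<Rightarrow> real) set" where
  "closed_simplex \<sigma> =
     {x. (\<forall>v. 0 \<le> x v) \<and> (\<forall>v. v \<notin> \<sigma> \<longrightarrow> x v = 0) \<and> (\<Sum>v\<in>\<sigma>. x v) = 1}"

definition open_simplex :: "'v set \<Rightarrow> ('v \<Rightarrow> real) set" where
  "open_simplex \<sigma> = {x \<in> closed_simplex \<sigma>. \<forall>v\<in>\<sigma>. 0 < x v}"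

definition realization_top :: "'v set set \<Rightarrow> ('v \<Rightarrow> real) topology" where
  "realization_top K =
     coherent_top K (\<lambda>\<sigma>. subtopology (powertop_real UNIV) (closed_simplex \<sigma>))"

lemma topspace_realization_top [simp]:
  "topspace (realization_top K) = (\<Union>\<sigma>\<in>K. closed_simplex \<sigma>)"
  by (simp add: realization_top_def)

definition triangulates ::
    "'v set set \<Rightarrow> (('v \<Rightarrow> real) \<Rightarrow> 'a) \<Rightarrow> 'a topology \<Rightarrow> bool" where
  "triangulates K h X \<longleftrightarrow>
     abs_simplicial_complex K \<and> homeomorphic_map (realization_top K) X h"

definition tame_triangulation ::
    "nat \<Rightarrow> 'v set set \<Rightarrow> (('v \<Rightarrow> real) \<Rightarrow> rinf set) \<Rightarrow> bool" where
  "tame_triangulation k K h \<longleftrightarrow>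
     triangulates K h (grass_inf_top k) \<and>
     (\<forall>\<sigma>\<in>K. \<forall>V \<in> h ` open_simplex \<sigma>. \<forall>W \<in> h ` open_simplex \<sigma>. \<forall>v\<in>V. \<exists>w\<in>W. \<forall>i.
        rinf_inner v (std_basis i) = 0 \<longleftrightarrow> rinf_inner w (std_basis i) = 0)"

end

theory Submission
  imports Defs
begin

text \<open>By tameness, planes in one open simplex have the same matroid of coordinate forms.
  Von Staudt's algebra of throws lets a matroid with enough extra coordinates force the cross
  ratio of four fixed coordinates to be an integer \<open>j\<close>.  Scaling the extra coordinates to 0
  moves such a plane to a plane \<open>V\<^sub>j\<close> in a fixed $\mathbb{R}^7$; having cross ratio \<open>j\<close>
  is a closed condition, so it holds on the whole open simplex containing \<open>V\<^sub>j\<close>.  Hence the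
  \<open>V\<^sub>j\<close> lie in pairwise distinct open simplices, although they converge: impossible,
  since points from distinct open simplices form a closed discrete set.\<close>

section \<open>Simplicial complexes\<close>

lemma closedin_coherent_top:
  "closedin (coherent_top I X) C \<longleftrightarrow>
     C \<subseteq> (\<Union>i\<in>I. topspace (X i)) \<and> (\<forall>i\<in>I. closedin (X i) (C \<inter> topspace (X i)))"
proof -
  have "(\<Union>i\<in>I. topspace (X i)) - C \<subseteq> (\<Union>i\<in>I. topspace (X i))" by blast
  moreover have "((\<Union>i\<in>I. topspace (X i)) - C) \<inter> topspace (X j) = topspace (X j) - C \<inter> topspace (X j)"
    if "j \<in> I" for j
    using that by blast
  ultimately show ?thesis
    by (simp add: closedin_def openin_coherent_top)
qed

lemma closedin_realization_top:
  "closedin (realization_top K) C \<longleftrightarrow>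
     C \<subseteq> (\<Union>\<sigma>\<in>K. closed_simplex \<sigma>) \<and>
     (\<forall>\<sigma>\<in>K. closedin (subtopology (powertop_real UNIV) (closed_simplex \<sigma>)) (C \<inter> closed_simplex \<sigma>))"
  by (simp add: realization_top_def closedin_coherent_top)

section \<open>Barycentric coordinates and carriers\<close>

lemma closed_simplex_memD:
  assumes "x \<in> closed_simplex \<sigma>"
  shows "0 \<le> x v" and "v \<notin> \<sigma> \<Longrightarrow> x v = 0"
  using assms by (auto simp: closed_simplex_def)

text \<open>A point recovers the simplex whose interior contains it, so distinct simplices have
  disjoint interiors.\<close>

lemma open_simplex_eq_support:
  assumes "x \<in> open_simplex \<sigma>"
  shows "\<sigma> = {v. x v \<noteq> 0}"
proof (intro set_eqI iffI)
  fix v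
  show "v \<in> {v. x v \<noteq> 0}" if "v \<in> \<sigma>"
    using assms that by (simp add: open_simplex_def less_le)
  show "v \<in> \<sigma>" if "v \<in> {v. x v \<noteq> 0}"
    using assms that by (auto simp: open_simplex_def closed_simplex_def)
qed

lemma closed_simplex_mono:
  assumes "\<sigma> \<subseteq> \<tau>" "finite \<tau>"
  shows "closed_simplex \<sigma> \<subseteq> closed_simplex \<tau>"
proof
  fix x assume x: "x \<in> closed_simplex \<sigma>"
  then have "sum x \<sigma> = sum x \<tau>"
    using assms by (intro sum.mono_neutral_left) (auto simp: closed_simplex_def)
  then show "x \<in> closed_simplex \<tau>" using x assms by (auto simp: closed_simplex_def)
qed

lemma open_simplex_subset_face:
  assumes "x \<in> open_simplex \<sigma>" "x \<in> closed_simplex \<tau>"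
  shows "\<sigma> \<subseteq> \<tau>"
  using open_simplex_eq_support[OF assms(1)] closed_simplex_memD(2)[OF assms(2)] by auto

lemma abs_simplicial_complexD:
  assumes "abs_simplicial_complex K" "\<tau> \<in> K"
  shows "finite \<tau>" and "\<sigma> \<subseteq> \<tau> \<Longrightarrow> \<sigma> \<noteq> {} \<Longrightarrow> \<sigma> \<in> K"
  using assms unfolding abs_simplicial_complex_def by blast+

lemma closed_simplex_carrier:
  assumes K: "abs_simplicial_complex K" and \<tau>: "\<tau> \<in> K" and x: "x \<in> closed_simplex \<tau>"
  obtains \<sigma> where "\<sigma> \<in> K" "\<sigma> \<subseteq> \<tau>" "x \<in> open_simplex \<sigma>"
proof -
  define \<sigma> where "\<sigma> = {v \<in> \<tau>. x v \<noteq> 0}"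
  have fin: "finite \<tau>" by (rule abs_simplicial_complexD[OF K \<tau>])
  have sum: "sum x \<sigma> = sum x \<tau>"
    by (rule sum.mono_neutral_left) (use fin in \<open>auto simp: \<sigma>_def\<close>)
  moreover have "sum x \<tau> = 1" using x by (simp add: closed_simplex_def)
  ultimately have "\<sigma> \<noteq> {}" by force
  moreover have "\<sigma> \<subseteq> \<tau>" by (auto simp: \<sigma>_def)
  ultimately have "\<sigma> \<in> K" by (rule abs_simplicial_complexD(2)[OF K \<tau>, rotated])
  have "x \<in> closed_simplex \<sigma>"
    unfolding closed_simplex_def mem_Collect_eq sum
    using x by (auto simp: closed_simplex_def \<sigma>_def)
  then have "x \<in> open_simplex \<sigma>"
    using closed_simplex_memD(1)[OF x] by (simp add: open_simplex_def \<sigma>_def less_le)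
  then show ?thesis by (rule that[OF \<open>\<sigma> \<in> K\<close> \<open>\<sigma> \<subseteq> \<tau>\<close>])
qed

lemma realization_carrier:
  assumes "abs_simplicial_complex K" "x \<in> topspace (realization_top K)"
  obtains \<sigma> where "\<sigma> \<in> K" "x \<in> open_simplex \<sigma>"
proof -
  obtain \<tau> where "\<tau> \<in> K" "x \<in> closed_simplex \<tau>" using assms(2) by auto
  then show ?thesis by (rule closed_simplex_carrier[OF assms(1)]) (rule that)
qed

section \<open>Closed sets and limits in the weak topology\<close>

lemma closed_simplex_closedin: "closedin (powertop_real UNIV) (closed_simplex \<sigma>)"
proof -
  have cont: "continuous_map (powertop_real UNIV) euclideanreal (\<lambda>x. x v)" for v :: 'a
    using continuous_map_product_coordinates[of v UNIV "\<lambda>_. euclideanreal"] by simp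
  have 1: "closedin (powertop_real UNIV) {x. 0 \<le> x v}" for v :: 'a
    using closedin_continuous_map_preimage[OF cont, of "{0..}" v] by simp
  have 2: "closedin (powertop_real UNIV) {x. x v = 0}" for v :: 'a
    using closedin_continuous_map_preimage[OF cont, of "{0}" v] by simp
  have "continuous_map (powertop_real UNIV) euclideanreal (\<lambda>x. \<Sum>v\<in>\<sigma>. x v)"
    \<comment> \<open>A sum over an infinite \<open>\<sigma>\<close> is 0 by convention, hence still
      continuous.\<close>
    by (cases "finite \<sigma>") (auto intro!: continuous_map_sum cont)
  from closedin_continuous_map_preimage[OF this, of "{1}"]
  have 3: "closedin (powertop_real UNIV) {x. (\<Sum>v\<in>\<sigma>. x v) = 1}"
    by simp
  have "closed_simplex \<sigma> =
      (\<Inter>v. {x. 0 \<le> x v}) \<inter> (\<Inter>v. if v \<in> \<sigma> then UNIV else {x. x v = 0}) \<inter> {x. (\<Sum>v\<in>\<sigma>. x v) = 1}"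
    by (auto simp: closed_simplex_def split: if_splits)
  moreover have "closedin (powertop_real UNIV) (UNIV :: ('a \<Rightarrow> real) set)"
    using closedin_topspace[of "powertop_real (UNIV :: 'a set)"] by simp
  ultimately show ?thesis
    using 1 2 3 by (auto intro!: closedin_Int closedin_Inter)
qed

text \<open>A closed simplex \<open>\<rho>\<close> meets the union in closed faces of
  \<open>\<rho>\<close>, of which there are only finitely many even when \<open>L\<close> is
  infinite.\<close>

lemma closedin_subcomplex:
  assumes K: "abs_simplicial_complex K" and L: "L \<subseteq> K"
  shows "closedin (realization_top K) (\<Union>\<tau>\<in>L. closed_simplex \<tau>)"
  unfolding closedin_realization_top
proof (intro conjI ballI)
  show "(\<Union>\<tau>\<in>L. closed_simplex \<tau>) \<subseteq> (\<Union>\<sigma>\<in>K. closed_simplex \<sigma>)" using L by blast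
  fix \<rho> assume \<rho>: "\<rho> \<in> K"
  have fin: "finite \<tau>" if "\<tau> \<in> K" for \<tau>
    by (rule abs_simplicial_complexD[OF K that])
  define F where "F = {\<phi>. \<phi> \<subseteq> \<rho> \<and> (\<exists>\<tau>\<in>L. \<phi> \<subseteq> \<tau>)}"
  have "finite F" using fin[OF \<rho>] by (auto simp: F_def)
  have eq: "(\<Union>\<tau>\<in>L. closed_simplex \<tau>) \<inter> closed_simplex \<rho> = (\<Union>\<phi>\<in>F. closed_simplex \<phi>)"
  proof (intro equalityI subsetI)
    fix x assume "x \<in> (\<Union>\<tau>\<in>L. closed_simplex \<tau>) \<inter> closed_simplex \<rho>"
    then obtain \<tau> where \<tau>: "\<tau> \<in> L" "x \<in> closed_simplex \<tau>" and x: "x \<in> closed_simplex \<rho>" by blast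
    obtain \<sigma> where "\<sigma> \<subseteq> \<rho>" "x \<in> open_simplex \<sigma>"
      using closed_simplex_carrier[OF K \<rho> x] by blast
    moreover from this have "\<sigma> \<subseteq> \<tau>" using open_simplex_subset_face \<tau>(2) by blast
    ultimately show "x \<in> (\<Union>\<phi>\<in>F. closed_simplex \<phi>)"
      using \<tau>(1) by (auto simp: F_def open_simplex_def)
  next
    fix x assume "x \<in> (\<Union>\<phi>\<in>F. closed_simplex \<phi>)"
    then obtain \<phi> \<tau> where \<phi>: "x \<in> closed_simplex \<phi>" "\<phi> \<subseteq> \<rho>" "\<phi> \<subseteq> \<tau>" and "\<tau> \<in> L"
      by (auto simp: F_def)
    then have "x \<in> closed_simplex \<rho>" "x \<in> closed_simplex \<tau>"
      using closed_simplex_mono fin \<rho> L by blast+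
    then show "x \<in> (\<Union>\<tau>\<in>L. closed_simplex \<tau>) \<inter> closed_simplex \<rho>"
      using \<open>\<tau> \<in> L\<close> by blast
  qed
  have "closedin (powertop_real UNIV) (\<Union>\<phi>\<in>F. closed_simplex \<phi>)"
    using \<open>finite F\<close> closed_simplex_closedin by (intro closedin_Union) auto
  then show "closedin (subtopology (powertop_real UNIV) (closed_simplex \<rho>))
      ((\<Union>\<tau>\<in>L. closed_simplex \<tau>) \<inter> closed_simplex \<rho>)"
    unfolding eq using eq by (intro closedin_subset_topspace) auto
qed

text \<open>The simplices \<open>\<tau> n\<close> with their faces form a subcomplex, and its
  realization is closed.\<close>

lemma limit_in_closed_simplex:
  assumes K: "abs_simplicial_complex K"
    and lim: "limitin (realization_top K) x l sequentially"
    and \<tau>: "\<And>n. \<tau> n \<in> K" "\<And>n. x n \<in> closed_simplex (\<tau> n)"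
  shows "\<exists>n. l \<in> closed_simplex (\<tau> n)"
proof -
  have "closedin (realization_top K) (\<Union>\<sigma>\<in>range \<tau>. closed_simplex \<sigma>)"
    using closedin_subcomplex[OF K] \<tau>(1) by blast
  then have "l \<in> (\<Union>\<sigma>\<in>range \<tau>. closed_simplex \<sigma>)"
    by (rule limitin_closedin[OF lim]) (use \<tau>(2) in \<open>auto intro!: always_eventually\<close>)
  then show ?thesis by blast
qed

text \<open>If all carriers were distinct, each closed simplex would contain only finitely many
  terms, having only finitely many faces. The terms other than \<open>l\<close> would then form a
  closed set, so the sequence would eventually be constant.\<close>

lemma convergent_sequence_repeats_open_simplex:
  assumes K: "abs_simplicial_complex K"
    and lim: "limitin (realization_top K) x l sequentially"
    and \<sigma>: "\<And>n. \<sigma> n \<in> K" "\<And>n. x n \<in> open_simplex (\<sigma> n)"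
  shows "\<exists>m n. m \<noteq> n \<and> \<sigma> m = \<sigma> n"
proof (rule ccontr)
  assume "\<not> ?thesis"
  then have inj: "inj \<sigma>" by (auto simp: inj_def)
  define S where "S = range x - {l}"
  have cl: "x n \<in> closed_simplex (\<sigma> n)" for n using \<sigma>(2) by (auto simp: open_simplex_def)
  have Haus: "Hausdorff_space (subtopology (powertop_real UNIV) (closed_simplex \<rho>))" for \<rho> :: "'a set"
    by (intro Hausdorff_space_subtopology) (simp add: Hausdorff_space_product_topology)
  have "closedin (realization_top K) S"
    unfolding closedin_realization_top
  proof (intro conjI ballI)
    show "S \<subseteq> (\<Union>\<sigma>\<in>K. closed_simplex \<sigma>)" using cl \<sigma>(1) by (auto simp: S_def)
    fix \<rho> assume "\<rho> \<in> K"
    then have "finite (Pow \<rho>)" using abs_simplicial_complexD[OF K] by simp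
    then have "finite (\<sigma> -` Pow \<rho>)" using inj by (simp add: finite_vimageI)
    moreover have "S \<inter> closed_simplex \<rho> \<subseteq> x ` (\<sigma> -` Pow \<rho>)"
      using open_simplex_subset_face[OF \<sigma>(2)] by (auto simp: S_def)
    ultimately have "finite (S \<inter> closed_simplex \<rho>)" using finite_surj by blast
    then show "closedin (subtopology (powertop_real UNIV) (closed_simplex \<rho>)) (S \<inter> closed_simplex \<rho>)"
      by (intro closedin_Hausdorff_finite[OF Haus]) auto
  qed
  then have "openin (realization_top K) (topspace (realization_top K) - S)" by blast
  then have "eventually (\<lambda>n. x n \<in> topspace (realization_top K) - S) sequentially"
    by (rule limitinD[OF lim]) (use limitin_topspace[OF lim] in \<open>auto simp: S_def\<close>)
  then obtain N where "\<And>n. n \<ge> N \<Longrightarrow> x n \<notin> S" by (auto simp: eventually_sequentially)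
  \<comment> \<open>Two consecutive terms that coincide have the same support, against injectivity
    of \<open>\<sigma>\<close>.\<close>
  then have "x N = l" "x (Suc N) = l" by (auto simp: S_def)
  then have "\<sigma> N = \<sigma> (Suc N)"
    using open_simplex_eq_support[OF \<sigma>(2)] by simp
  then show False using inj by (simp add: inj_eq)
qed

text \<open>The open simplex is dense in the closed one: \<open>z n\<close> tends to
  \<open>y\<close> along the segment from the interior point \<open>b\<close> and stays interior
  because \<open>b\<close> has positive weight.\<close>

lemma closed_simplex_subset_closedin:
  assumes K: "abs_simplicial_complex K" and \<tau>: "\<tau> \<in> K"
    and C: "closedin (realization_top K) C" "open_simplex \<tau> \<subseteq> C"
    and b: "b \<in> open_simplex \<tau>"
  shows "closed_simplex \<tau> \<subseteq> C"
proof
  fix y assume y: "y \<in> closed_simplex \<tau>"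
  define z where "z n = (\<lambda>v. y v + inverse (real (Suc n)) * (b v - y v))" for n
  have b': "b \<in> closed_simplex \<tau>" "\<And>v. v \<in> \<tau> \<Longrightarrow> 0 < b v"
    using b by (auto simp: open_simplex_def)
  have z_open: "z n \<in> open_simplex \<tau>" for n
  proof -
    define t where "t = inverse (real (Suc n))"
    have t: "0 < t" "t \<le> 1" by (auto simp: t_def field_simps)
    have z: "z n = (\<lambda>v. (1 - t) * y v + t * b v)"
      by (simp add: z_def t_def fun_eq_iff algebra_simps)
    have "(\<Sum>v\<in>\<tau>. z n v) = 1"
      using y b'(1) unfolding z
      by (simp add: closed_simplex_def sum.distrib flip: sum_distrib_left)
    moreover have "0 \<le> z n v" for v
      using t closed_simplex_memD(1)[OF y] closed_simplex_memD(1)[OF b'(1)] by (simp add: z)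
    moreover have "0 < z n v" if "v \<in> \<tau>" for v
      using t closed_simplex_memD(1)[OF y, of v] b'(2)[OF that]
      by (auto simp: z intro!: add_nonneg_pos)
    moreover have "z n v = 0" if "v \<notin> \<tau>" for v
      using that y b'(1) by (simp add: z closed_simplex_def)
    ultimately show ?thesis by (auto simp: open_simplex_def closed_simplex_def)
  qed
  have lim1: "(\<lambda>n. z n v) \<longlonglongrightarrow> y v" for v
    unfolding z_def by (rule tendsto_eq_intros LIMSEQ_inverse_real_of_nat refl | simp)+
  then have lim: "limitin (powertop_real UNIV) z y sequentially"
    by (simp add: limitin_componentwise)
  \<comment> \<open>Weak closedness on one simplex is closedness in the product, where
    coordinatewise limits apply.\<close>
  have "closedin (powertop_real UNIV) (C \<inter> closed_simplex \<tau>)"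
    by (rule closedin_trans_full[OF _ closed_simplex_closedin[of \<tau>]])
      (use C(1) \<tau> in \<open>simp add: closedin_realization_top\<close>)
  moreover have "z n \<in> C \<inter> closed_simplex \<tau>" for n
    using z_open C(2) by (auto simp: open_simplex_def)
  ultimately show "y \<in> C"
    using limitin_closedin[OF lim, of "C \<inter> closed_simplex \<tau>"] by simp
qed

section \<open>Convergence in the infinite Grassmannian\<close>

abbreviation coord :: "rinf \<Rightarrow> nat \<Rightarrow> real" where
  "coord \<equiv> Poly_Mapping.lookup"

lemma coord_scaleR [simp]: "coord (c *\<^sub>R v) k = c * coord v k"
proof -
  have "finite {i. c * coord v i \<noteq> 0}"
    by (rule finite_subset[of _ "Poly_Mapping.keys v"]) (auto simp: in_keys_iff)
  then show ?thesis by (simp add: scaleR_poly_mapping_def)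
qed

lemma coord_diff [simp]: "coord (v - w) k = coord v k - coord w k"
  by (rule lookup_minus)

text \<open>Each coordinate is dominated by the l1 norm, hence is a bounded linear
  functional.\<close>

lemma continuous_on_coord: "continuous_on S (\<lambda>v. coord v k)"
proof -
  have "\<bar>coord v k\<bar> \<le> norm v" for v
  proof (cases "k \<in> Poly_Mapping.keys v")
    case True
    then show ?thesis
      unfolding norm_poly_mapping_def dist_poly_mapping_def
      using member_le_sum[of k "Poly_Mapping.keys v" "\<lambda>k. norm (coord v k)"] by simp
  qed (simp add: in_keys_iff)
  then have "bounded_linear (\<lambda>v. coord v k)"
    by (intro bounded_linear_intro[where K=1]) (simp_all add: lookup_add)
  then show ?thesis by (rule bounded_linear.continuous_on) (rule continuous_on_id)
qed

lemma span_indexed_image: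
  fixes f :: "'i \<Rightarrow> 'a::real_vector"
  assumes "finite I" "inj_on f I"
  shows "span (f ` I) = range (\<lambda>a. \<Sum>i\<in>I. a i *\<^sub>R f i)"
proof (intro equalityI subsetI)
  fix v assume "v \<in> span (f ` I)"
  then obtain u where "v = (\<Sum>b\<in>f ` I. u b *\<^sub>R b)"
    using assms(1) by (auto simp: span_finite)
  then have "v = (\<Sum>i\<in>I. (u \<circ> f) i *\<^sub>R f i)"
    by (simp add: sum.reindex[OF assms(2)])
  then show "v \<in> range (\<lambda>a. \<Sum>i\<in>I. a i *\<^sub>R f i)" by blast
qed (auto intro!: span_sum span_scale intro: span_base)

text \<open>Limits of frames pass through two continuous maps: the quotient map taking spans and the
  inclusion into the colimit.\<close>

lemma limitin_grass_inf_top: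
  assumes F: "\<And>n. F n \<in> frames k N" and f: "f \<in> frames k N"
    and lim: "\<And>i. i < k \<Longrightarrow> (\<lambda>n. F n i) \<longlonglongrightarrow> f i"
  shows "limitin (grass_inf_top k) (\<lambda>n. span (F n ` {..<k})) (span (f ` {..<k})) sequentially"
proof -
  have "limitin (product_topology (\<lambda>i. top_of_set (rn N)) {..<k}) F f sequentially"
    unfolding limitin_componentwise
  proof (intro conjI ballI)
    show "f \<in> extensional {..<k}" "\<forall>\<^sub>F n in sequentially. F n \<in> topspace (product_topology (\<lambda>i. top_of_set (rn N)) {..<k})"
      using F f by (auto simp: frames_def PiE_def)
    fix i assume i: "i \<in> {..<k}"
    then have "F n i \<in> rn N" "f i \<in> rn N" for n
      using F[of n] f by (auto simp: frames_def)
    then show "limitin (top_of_set (rn N)) (\<lambda>n. F n i) (f i) sequentially"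
      using lim i by (simp add: limitin_subtopology)
  qed
  then have 1: "limitin (frames_top k N) F f sequentially"
    unfolding frames_top_def by (simp add: limitin_subtopology F f)
  have 2: "continuous_map (frames_top k N) (grass_top k N) (\<lambda>f. span (f ` {..<k}))"
    unfolding grass_top_def by (rule quotient_imp_continuous_map[OF quotient_map_quotient_top])
  have 3: "continuous_map (grass_top k N) (grass_inf_top k) id"
    unfolding continuous_map_def
  proof (intro conjI allI impI)
    show "id \<in> topspace (grass_top k N) \<rightarrow> topspace (grass_inf_top k)"
      by (auto simp: grass_inf_def)
    fix U assume "openin (grass_inf_top k) U"
    then have "openin (grass_top k N) (U \<inter> grass k N)"
      by (simp add: grass_inf_top_def openin_coherent_top)
    moreover have "{V \<in> topspace (grass_top k N). id V \<in> U} = U \<inter> grass k N" by auto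
    ultimately show "openin (grass_top k N) {V \<in> topspace (grass_top k N). id V \<in> U}" by simp
  qed
  show ?thesis
    using continuous_map_limit[OF continuous_map_compose[OF 2 3] 1] by (simp add: comp_def)
qed

section \<open>Planes with a prescribed cross ratio\<close>

text \<open>The wedge of the coordinate forms \<open>a\<close> and \<open>b\<close>, evaluated at
  \<open>v\<close> and \<open>w\<close>. For forms in a common two-dimensional space, these values
  are determinants in a basis up to a common factor, which cancels in a cross ratio.\<close>

definition coord_minor :: "rinf \<Rightarrow> rinf \<Rightarrow> nat \<Rightarrow> nat \<Rightarrow> real" where
  "coord_minor v w a b = coord v a * coord w b - coord v b * coord w a"

text \<open>The condition says that the restrictions of the coordinate forms 0, 4, 6, 3 have
  cross ratio \<^term>\<open>m\<close>, with denominators cleared so that it is closed.\<close>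

definition cross_ratio_planes :: "real \<Rightarrow> rinf set set" where
  "cross_ratio_planes m = {W \<in> grass_inf 3. \<forall>v\<in>W. \<forall>w\<in>W.
     coord_minor v w 0 6 * coord_minor v w 4 3 = m * coord_minor v w 0 3 * coord_minor v w 4 6}"

text \<open>Closedness is checked on frames, through the colimit and the quotient map. There the
  pairs of vectors in the span are \<open>L a f\<close> and \<open>L b f\<close>, and each choice of
  coefficients \<open>a\<close>, \<open>b\<close> gives one continuous equation in
  \<open>f\<close>.\<close>

lemma closedin_cross_ratio_planes: "closedin (grass_inf_top 3) (cross_ratio_planes m)"
proof -
  have "closedin (grass_top 3 n) (cross_ratio_planes m \<inter> grass 3 n)" for n
  proof -
    define D where "D v w = coord_minor v w 0 6 * coord_minor v w 4 3
       - m * coord_minor v w 0 3 * coord_minor v w 4 6" for v w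
    define L :: "(nat \<Rightarrow> real) \<Rightarrow> (nat \<Rightarrow> rinf) \<Rightarrow> rinf" where "L a f = (\<Sum>i<3. a i *\<^sub>R f i)" for a f
    have c1: "continuous_map (frames_top 3 n) euclideanreal (\<lambda>f. coord (f i) k)" if "i < 3" for i k
    proof -
      have "continuous_map (product_topology (\<lambda>i. top_of_set (rn n)) {..<3}) (top_of_set (rn n)) (\<lambda>f. f i)"
        by (rule continuous_map_product_coordinates) (use that in simp)
      moreover have "continuous_map (top_of_set (rn n)) euclideanreal (\<lambda>v. coord v k)"
        using continuous_on_coord[of "rn n" k] by simp
      ultimately have "continuous_map (product_topology (\<lambda>i. top_of_set (rn n)) {..<3}) euclideanreal (\<lambda>f. coord (f i) k)"
        using continuous_map_compose[of _ _ "\<lambda>f. f i" _ "\<lambda>v. coord v k"] by (simp add: comp_def)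
      then show ?thesis unfolding frames_top_def by (rule continuous_map_from_subtopology)
    qed
    have c2: "continuous_map (frames_top 3 n) euclideanreal (\<lambda>f. coord (L a f) k)" for a k
      unfolding L_def lookup_sum coord_scaleR
      by (intro continuous_map_sum continuous_map_real_mult c1 continuous_map_const[THEN iffD2]) auto
    have c3: "continuous_map (frames_top 3 n) euclideanreal (\<lambda>f. D (L a f) (L b f))" for a b
      unfolding D_def coord_minor_def
      by (intro continuous_map_diff continuous_map_real_mult c2) auto
    have "closedin (frames_top 3 n) {f \<in> topspace (frames_top 3 n). D (L a f) (L b f) \<in> {0}}" for a b
      by (rule closedin_continuous_map_preimage[OF c3]) simp
    then have cl: "closedin (frames_top 3 n) (\<Inter>(a, b)\<in>UNIV. {f \<in> topspace (frames_top 3 n). D (L a f) (L b f) \<in> {0}})"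
      by (intro closedin_Inter) auto
    have gr: "span (f ` {..<3}) \<in> grass 3 n" if "f \<in> frames 3 n" for f
      using quotient_imp_continuous_map[OF quotient_map_quotient_top[of "frames_top 3 n" "\<lambda>f. span (f ` {..<3})"]] that
      by (auto simp: continuous_map_def topspace_frames_top simp flip: grass_top_def)
    have "{f \<in> topspace (frames_top 3 n). span (f ` {..<3}) \<in> cross_ratio_planes m \<inter> grass 3 n} =
       (\<Inter>(a, b)\<in>UNIV. {f \<in> topspace (frames_top 3 n). D (L a f) (L b f) \<in> {0}})"
    proof -
      have "span (f ` {..<3}) \<in> cross_ratio_planes m \<inter> grass 3 n \<longleftrightarrow> (\<forall>a b. D (L a f) (L b f) = 0)"
        if f: "f \<in> frames 3 n" for f
      proof -
        have "span (f ` {..<3}) = range (\<lambda>a. L a f)"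
          unfolding L_def by (rule span_indexed_image) (use f in \<open>auto simp: frames_def\<close>)
        then show ?thesis
          using gr[OF f] by (auto simp: cross_ratio_planes_def grass_inf_def D_def)
      qed
      then show ?thesis by (auto simp: topspace_frames_top)
    qed
    then have "closedin (frames_top 3 n) {f \<in> topspace (frames_top 3 n). span (f ` {..<3}) \<in> cross_ratio_planes m \<inter> grass 3 n}"
      using cl by simp
    moreover have "quotient_map (frames_top 3 n) (grass_top 3 n) (\<lambda>f. span (f ` {..<3}))"
      unfolding grass_top_def by (rule quotient_map_quotient_top)
    ultimately show ?thesis by (auto simp: quotient_map_closedin)
  qed
  then show ?thesis
    unfolding grass_inf_top_def closedin_coherent_top
    by (auto simp: cross_ratio_planes_def grass_inf_def)
qed

section \<open>Von Staudt planes\<close>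

text \<open>With \<^term>\<open>e \<noteq> 0\<close> and \<^term>\<open>c = 1 / real j\<close>, form 3 is proportional to form
  \<^term>\<open>2 * j + 4\<close>; the forms from 4 on pin down the multiples of form 0 one at a time.\<close>

definition staudt_form :: "real \<Rightarrow> real \<Rightarrow> nat \<Rightarrow> real \<Rightarrow> real \<Rightarrow> real \<Rightarrow> real" where
  "staudt_form c e k x y z =
     (if k = 0 then x else if k = 1 then y else if k = 2 then y - x else if k = 3 then x + c * z
      else (if k < 7 then 1 else e) * (z + real ((k - 4) div 2) * x + (if odd k then y else 0)))"

definition staudt_vector :: "nat \<Rightarrow> real \<Rightarrow> real \<Rightarrow> real \<Rightarrow> real \<Rightarrow> real \<Rightarrow> rinf" where
  "staudt_vector N c e x y z = (\<Sum>k<N. staudt_form c e k x y z *\<^sub>R std_basis k)"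

definition staudt_plane :: "nat \<Rightarrow> real \<Rightarrow> real \<Rightarrow> rinf set" where
  "staudt_plane N c e = {staudt_vector N c e x y z | x y z. True}"

definition staudt_frame :: "nat \<Rightarrow> real \<Rightarrow> real \<Rightarrow> nat \<Rightarrow> rinf" where
  "staudt_frame N c e = (\<lambda>i\<in>{..<3}. staudt_vector N c e (of_bool (i = 0)) (of_bool (i = 1)) (of_bool (i = 2)))"

lemma coord_staudt_vector [simp]:
  "coord (staudt_vector N c e x y z) k = (if k < N then staudt_form c e k x y z else 0)"
  by (simp add: staudt_vector_def lookup_sum std_basis_def lookup_single when_def
      if_distrib[of "\<lambda>x. _ * x"] cong: if_cong)

text \<open>The first seven forms do not involve \<open>e\<close>, and \<open>e = 0\<close> kills
  all later ones.\<close>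

lemma staudt_vector_truncate: "7 \<le> N \<Longrightarrow> staudt_vector N c 0 x y z = staudt_vector 7 c e x y z"
  by (rule poly_mapping_eqI) (auto simp: staudt_form_def)

lemma staudt_plane_truncate: "7 \<le> N \<Longrightarrow> staudt_plane N c 0 = staudt_plane 7 c e"
  by (simp add: staudt_plane_def staudt_vector_truncate[of N c _ _ _ e])

lemma staudt_frame_combination:
  "(\<Sum>i<3. a i *\<^sub>R staudt_frame N c e i) = staudt_vector N c e (a 0) (a 1) (a 2)"
  by (rule poly_mapping_eqI)
    (auto simp: staudt_frame_def staudt_form_def lookup_add eval_nat_numeral algebra_simps)

text \<open>Forms 0, 1 and 4 are x, y and z, so the frame is independent for all \<open>c\<close>
  and \<open>e\<close>; the bound 5 makes room for form 4.\<close>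

lemma staudt_frame_in_frames:
  assumes "5 \<le> N"
  shows "staudt_frame N c e \<in> frames 3 N"
proof -
  have rn: "staudt_frame N c e \<in> {..<3} \<rightarrow>\<^sub>E rn N"
    by (auto simp: staudt_frame_def rn_def in_keys_iff split: if_splits)
  have zero: "a 0 = 0 \<and> a 1 = 0 \<and> a 2 = 0" if "(\<Sum>i<3. a i *\<^sub>R staudt_frame N c e i) = 0" for a
  proof -
    have "coord (staudt_vector N c e (a 0) (a 1) (a 2)) k = 0" for k
      using that by (simp add: staudt_frame_combination)
    from this[of 0] this[of 1] this[of 4] show ?thesis
      using assms by (simp add: staudt_form_def)
  qed
  have inj: "inj_on (staudt_frame N c e) {..<3}"
  proof (rule inj_onI)
    fix i j :: nat assume ij: "i \<in> {..<3}" "j \<in> {..<3}" "staudt_frame N c e i = staudt_frame N c e j"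
    show "i = j"
    proof (rule ccontr)
      assume "i \<noteq> j"
      \<comment> \<open>Equal vectors at distinct indices would give a vanishing combination with
        coefficients 1 and -1.\<close>
      have "(\<Sum>l<3. (of_bool (l = i) - of_bool (l = j)) *\<^sub>R staudt_frame N c e l)
          = staudt_frame N c e i - staudt_frame N c e j"
        using ij by (simp add: algebra_simps sum_subtractf of_bool_def if_distrib[of "\<lambda>r. r *\<^sub>R _"] cong: if_cong)
      then have "(\<Sum>l<3. (of_bool (l = i) - of_bool (l = j)) *\<^sub>R staudt_frame N c e l) = 0"
        using ij(3) by simp
      from zero[OF this] show False
        using ij(1) \<open>i \<noteq> j\<close> by (auto simp: eval_nat_numeral less_Suc_eq)
    qed
  qed
  have "independent (staudt_frame N c e ` {..<3})"
  proof
    assume "dependent (staudt_frame N c e ` {..<3})"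
    then obtain u v where v: "v \<in> staudt_frame N c e ` {..<3}" "u v \<noteq> 0"
      and u: "(\<Sum>v\<in>staudt_frame N c e ` {..<3}. u v *\<^sub>R v) = 0"
      by (auto simp: dependent_finite)
    then have "(\<Sum>i<3. (u \<circ> staudt_frame N c e) i *\<^sub>R staudt_frame N c e i) = 0"
      by (simp add: sum.reindex[OF inj])
    from zero[OF this] show False
      using v by (auto simp: eval_nat_numeral less_Suc_eq lessThan_Suc)
  qed
  then show ?thesis using rn inj by (simp add: frames_def)
qed

lemma span_staudt_frame:
  assumes "5 \<le> N"
  shows "span (staudt_frame N c e ` {..<3}) = staudt_plane N c e"
proof -
  have "span (staudt_frame N c e ` {..<3}) = range (\<lambda>a :: nat \<Rightarrow> real. staudt_vector N c e (a 0) (a 1) (a 2))"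
    using staudt_frame_in_frames[OF assms, of c e]
    by (subst span_indexed_image) (auto simp: frames_def staudt_frame_combination)
  also have "\<dots> = staudt_plane N c e"
  proof (intro equalityI subsetI)
    fix v assume "v \<in> staudt_plane N c e"
    then obtain x y z where "v = staudt_vector N c e x y z" by (auto simp: staudt_plane_def)
    then show "v \<in> range (\<lambda>a :: nat \<Rightarrow> real. staudt_vector N c e (a 0) (a 1) (a 2))"
      by (intro image_eqI[of _ _ "\<lambda>i::nat. if i = 0 then x else if i = 1 then y else z"]) auto
  qed (auto simp: staudt_plane_def)
  finally show ?thesis .
qed

lemma limitin_staudt_plane:
  assumes "5 \<le> N" "c \<longlonglongrightarrow> c'" "e \<longlonglongrightarrow> e'"
  shows "limitin (grass_inf_top 3) (\<lambda>n. staudt_plane N (c n) (e n)) (staudt_plane N c' e') sequentially"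
proof -
  have "(\<lambda>n. staudt_form (c n) (e n) k x y z) \<longlonglongrightarrow> staudt_form c' e' k x y z" for k x y z
    unfolding staudt_form_def by (auto intro!: tendsto_intros assms)
  then have "(\<lambda>n. staudt_frame N (c n) (e n) i) \<longlonglongrightarrow> staudt_frame N c' e' i" if "i < 3" for i
    unfolding staudt_frame_def staudt_vector_def
    using that by (auto intro!: tendsto_intros)
  from limitin_grass_inf_top[OF staudt_frame_in_frames staudt_frame_in_frames this]
  show ?thesis using assms(1) by (simp add: span_staudt_frame)
qed

text \<open>The plane is the limit of a constant sequence, and limits lie in the underlying
  space.\<close>

lemma staudt_plane_in_grass_inf: "5 \<le> N \<Longrightarrow> staudt_plane N c e \<in> grass_inf 3"
  using limitin_topspace[OF limitin_staudt_plane[of N "\<lambda>_. c" c "\<lambda>_. e" e]] by simp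

lemma staudt_plane_cross_ratio:
  assumes "0 < j" "staudt_plane 7 (1 / j) e \<in> cross_ratio_planes m"
  shows "m = j"
proof -
  \<comment> \<open>Forms 0, 4, 6, 3 are x, z, x + z, x + z/j. On this pair the four minors, in the
    order of the equation, are 1, -1, 1/j, -1.\<close>
  let ?v = "staudt_vector 7 (1 / j) e 1 0 0" and ?w = "staudt_vector 7 (1 / j) e 0 0 1"
  have "coord_minor ?v ?w 0 6 * coord_minor ?v ?w 4 3 = m * coord_minor ?v ?w 0 3 * coord_minor ?v ?w 4 6"
    using assms(2) unfolding cross_ratio_planes_def staudt_plane_def by blast
  then show ?thesis
    using assms(1) by (simp add: coord_minor_def staudt_form_def)
qed

section \<open>Zero patterns and von Staudt's construction\<close>

text \<open>The zero pattern of a von Staudt vector with \<open>c = 1 / real j\<close> and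
  \<open>e\<close> nonzero, imposed on an arbitrary \<open>w\<close>: this is the information that
  tameness transfers. Form 3 gets the condition of form \<open>2 * j + 4\<close>.\<close>

definition staudt_zeros :: "nat \<Rightarrow> rinf \<Rightarrow> real \<Rightarrow> real \<Rightarrow> real \<Rightarrow> bool" where
  "staudt_zeros j w x y z \<longleftrightarrow>
     (coord w 0 = 0 \<longleftrightarrow> x = 0) \<and> (coord w 1 = 0 \<longleftrightarrow> y = 0) \<and> (coord w 2 = 0 \<longleftrightarrow> y = x) \<and>
     (coord w 3 = 0 \<longleftrightarrow> z + real j * x = 0) \<and>
     (\<forall>i\<le>j. (coord w (2 * i + 4) = 0 \<longleftrightarrow> z + real i * x = 0) \<and>
            (coord w (2 * i + 5) = 0 \<longleftrightarrow> z + y + real i * x = 0))"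

lemma staudt_zeros_staudt_vector:
  assumes "0 < j" "e \<noteq> 0"
  shows "staudt_zeros j (staudt_vector (2 * j + 6) (1 / real j) e x y z) x y z"
proof -
  have even: "staudt_form c e (2 * i + 4) x y z = 0 \<longleftrightarrow> z + real i * x = 0" for c i
    using assms(2) by (simp add: staudt_form_def)
  have odd: "staudt_form c e (2 * i + 5) x y z = 0 \<longleftrightarrow> z + y + real i * x = 0" for c i
  proof -
    have "staudt_form c e (2 * i + 5) x y z = (if 2 * i + 5 < 7 then 1 else e) * (z + y + real i * x)"
      by (simp add: staudt_form_def)
    then show ?thesis using assms(2) by simp
  qed
  show ?thesis
    unfolding staudt_zeros_def
    using assms even odd by (auto simp: staudt_form_def[of _ _ 0] staudt_form_def[of _ _ 1]
        staudt_form_def[of _ _ 2] staudt_form_def[of _ _ 3] staudt_form_def[of _ _ "Suc 0"] field_simps)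
qed

text \<open>A form that vanishes wherever two others do is determined up to scale by testing it on a
  vector killed by both. Alternating even and odd forms adds form 0 once per round, so
  \<open>j\<close> rounds build the coefficient \<open>j\<close>. Form 3 is then compared with the
  result.\<close>

lemma von_staudt:
  assumes W: "subspace W" and j: "0 < j"
    and pat: "\<And>w. w \<in> W \<Longrightarrow> \<exists>x y z. staudt_zeros j w x y z \<and> (x = 0 \<and> y = 0 \<and> z = 0 \<longrightarrow> w = 0)"
    and ex: "\<And>x y z. \<exists>w\<in>W. staudt_zeros j w x y z"
    and vw: "v \<in> W" "w \<in> W"
  shows "coord_minor v w 0 6 * coord_minor v w 4 3 = real j * coord_minor v w 0 3 * coord_minor v w 4 6"
proof -
  have evenD: "coord w (2 * i + 4) = 0 \<longleftrightarrow> z + real i * x = 0"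
    and oddD: "coord w (2 * i + 5) = 0 \<longleftrightarrow> z + y + real i * x = 0"
    if "staudt_zeros j w x y z" "i \<le> j" for w x y z i
    using that by (auto simp: staudt_zeros_def)
  have base: "coord w 0 = 0 \<longleftrightarrow> x = 0" "coord w 1 = 0 \<longleftrightarrow> y = 0" "coord w 2 = 0 \<longleftrightarrow> y = x"
     "coord w 3 = 0 \<longleftrightarrow> z + real j * x = 0" "coord w 4 = 0 \<longleftrightarrow> z = 0" "coord w 5 = 0 \<longleftrightarrow> z + y = 0"
    if "staudt_zeros j w x y z" for w x y z
    using that evenD[OF that, of 0] oddD[OF that, of 0] by (auto simp: staudt_zeros_def)
  obtain p0 where p0: "p0 \<in> W" "staudt_zeros j p0 1 0 0" using ex by blast
  obtain q0 where q0: "q0 \<in> W" "staudt_zeros j q0 0 1 0" using ex by blast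
  obtain r0 where r0: "r0 \<in> W" "staudt_zeros j r0 0 0 1" using ex by blast
  note zp = base[OF p0(2)] and zq = base[OF q0(2)] and zr = base[OF r0(2)]
  \<comment> \<open>A basis of \<^term>\<open>W\<close> scaled so that, in the coordinates \<open>(x, y, z)\<close> it defines, form 2 is
    \<open>y - x\<close> and form 5 is proportional to \<open>z + y\<close>; this leaves no freedom in forms 4 onwards
    beyond a scalar factor for each.\<close>
  define p where "p = (1 / - coord p0 2) *\<^sub>R p0"
  define q where "q = (1 / coord q0 2) *\<^sub>R q0"
  define r where "r = (coord q 5 / coord r0 5) *\<^sub>R r0"
  have in_W: "p \<in> W" "q \<in> W" "r \<in> W"
    using p0 q0 r0 W by (auto simp: p_def q_def r_def intro!: subspace_scale simp del: divide_minus_right)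
  have p: "coord p 0 \<noteq> 0" "coord p 1 = 0" "coord p 2 = -1" "coord p 4 = 0" "coord p 5 = 0"
    using zp by (auto simp: p_def)
  have q: "coord q 0 = 0" "coord q 1 \<noteq> 0" "coord q 2 = 1" "coord q 3 = 0" "coord q 4 = 0" "coord q 5 \<noteq> 0"
    using zq by (auto simp: q_def)
  have r: "coord r 0 = 0" "coord r 1 = 0" "coord r 2 = 0" "coord r 4 \<noteq> 0" "coord r 5 = coord q 5"
    using zr q(6) by (auto simp: r_def)
  \<comment> \<open>In the coordinates given by \<open>p\<close>, \<open>q\<close>,
    \<open>r\<close>, forms \<open>2 * i + 4\<close> and \<open>2 * i + 5\<close> are multiples of z
    + i x and z + y + i x.\<close>
  have chain: "coord p (2 * i + 4) = real i * coord r (2 * i + 4) \<and> coord q (2 * i + 4) = 0 \<and>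
     coord p (2 * i + 5) = real i * coord r (2 * i + 5) \<and> coord q (2 * i + 5) = coord r (2 * i + 5)"
    if "i \<le> j" for i
    using that
  proof (induction i)
    case 0
    then show ?case using p q r by simp
  next
    case (Suc i)
    then have i: "i \<le> j" and IH: "coord p (2 * i + 4) = real i * coord r (2 * i + 4)" "coord q (2 * i + 4) = 0"
      "coord p (2 * i + 5) = real i * coord r (2 * i + 5)" "coord q (2 * i + 5) = coord r (2 * i + 5)"
      by auto
    \<comment> \<open>From y = x and z + y + i x = 0 follows z + (i + 1) x = 0: here the coefficient
      increases.\<close>
    have even: "coord w (2 * Suc i + 4) = 0"
      if "w \<in> W" "coord w 2 = 0" "coord w (2 * i + 5) = 0" for w
    proof -
      obtain x y z where z: "staudt_zeros j w x y z" using pat[OF \<open>w \<in> W\<close>] by blast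
      show ?thesis
        using that base[OF z] oddD[OF z i] evenD[OF z Suc.prems] by (simp add: algebra_simps)
    qed
    have qe: "coord q (2 * Suc i + 4) = 0"
      using evenD[OF q0(2) Suc.prems] by (simp add: q_def)
    \<comment> \<open>By the induction hypothesis forms 2 and \<open>2 * i + 5\<close> both kill
      this vector.\<close>
    have "p + q - real (Suc i) *\<^sub>R r \<in> W"
      using in_W W by (intro subspace_diff subspace_add subspace_scale)
    from even[OF this] have pe: "coord p (2 * Suc i + 4) = real (Suc i) * coord r (2 * Suc i + 4)"
      using IH p q r qe by (simp add: lookup_add algebra_simps)
    \<comment> \<open>With y = 0 the new odd form has the zeros of the new even form, so it inherits
      the coefficient of x.\<close>
    have "coord w (2 * Suc i + 5) = 0"
      if "w \<in> W" "coord w 1 = 0" "coord w (2 * Suc i + 4) = 0" for w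
    proof -
      obtain x y z where z: "staudt_zeros j w x y z" using pat[OF \<open>w \<in> W\<close>] by blast
      show ?thesis
        using that base[OF z] oddD[OF z Suc.prems] evenD[OF z Suc.prems] by (simp add: algebra_simps)
    qed
    from this[of "p - real (Suc i) *\<^sub>R r"]
    have "coord (p - real (Suc i) *\<^sub>R r) (2 * Suc i + 5) = 0"
      using pe p r in_W W by (simp add: subspace_diff subspace_scale)
    then have po: "coord p (2 * Suc i + 5) = real (Suc i) * coord r (2 * Suc i + 5)"
      by simp
    \<comment> \<open>With x = 0 every odd form vanishes where form 5 does; the test vector
      \<open>q - r\<close> equates the coefficients of y and z.\<close>
    have "coord w (2 * Suc i + 5) = 0"
      if "w \<in> W" "coord w 0 = 0" "coord w 5 = 0" for w
    proof -
      obtain x y z where z: "staudt_zeros j w x y z" using pat[OF \<open>w \<in> W\<close>] by blast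
      show ?thesis
        using that base[OF z] oddD[OF z Suc.prems] by simp
    qed
    from this[of "q - r"] have "coord (q - r) (2 * Suc i + 5) = 0"
      using q r in_W W by (simp add: subspace_diff)
    then show ?case using pe qe po by simp
  qed
  \<comment> \<open>Form 3 has the zeros of form \<open>2 * j + 4\<close>, which kills
    \<open>p - real j *\<^sub>R r\<close>.\<close>
  have "coord w 3 = 0" if "w \<in> W" "coord w (2 * j + 4) = 0" for w
  proof -
    obtain x y z where z: "staudt_zeros j w x y z" using pat[OF \<open>w \<in> W\<close>] by blast
    show ?thesis
      using that base[OF z] evenD[OF z, of j] by simp
  qed
  from this[of "p - real j *\<^sub>R r"] have "coord (p - real j *\<^sub>R r) 3 = 0"
    using chain[of j] in_W W by (simp add: subspace_diff subspace_scale)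
  then have p3: "coord p 3 = real j * coord r 3" by simp
  have p6: "coord p 6 = coord r 6" "coord q 6 = 0"
    using chain[of 1] j by auto
  \<comment> \<open>The remainder \<open>d\<close> has parameters x = y = z = 0, and
    \<open>pat\<close> says that only the zero vector does.\<close>
  have decomp: "\<exists>x y z. w = x *\<^sub>R p + y *\<^sub>R q + z *\<^sub>R r" if "w \<in> W" for w
  proof -
    define d where "d = w - ((coord w 0 / coord p 0) *\<^sub>R p + (coord w 1 / coord q 1) *\<^sub>R q + (coord w 4 / coord r 4) *\<^sub>R r)"
    have "d \<in> W"
      unfolding d_def using in_W W that by (intro subspace_diff subspace_add subspace_scale)
    then obtain x y z where z: "staudt_zeros j d x y z" and d0: "x = 0 \<and> y = 0 \<and> z = 0 \<longrightarrow> d = 0"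
      using pat by blast
    have "coord d 0 = 0" "coord d 1 = 0" "coord d 4 = 0"
      using p q r by (simp_all add: d_def lookup_add)
    then have "d = 0" using base[OF z] d0 by simp
    then show ?thesis unfolding d_def by (auto simp: algebra_simps)
  qed
  obtain x y z where v: "v = x *\<^sub>R p + y *\<^sub>R q + z *\<^sub>R r" using decomp vw(1) by blast
  obtain x' y' z' where w: "w = x' *\<^sub>R p + y' *\<^sub>R q + z' *\<^sub>R r" using decomp vw(2) by blast
  \<comment> \<open>Forms 0, 4, 3, 6 are multiples of x, z, j x + z, x + z. Each occurs once on
    either side of the equation, so the unknown factors cancel.\<close>
  have c: "coord v 0 = x * coord p 0" "coord w 0 = x' * coord p 0"
     "coord v 4 = z * coord r 4" "coord w 4 = z' * coord r 4"
     "coord v 3 = (j * x + z) * coord r 3" "coord w 3 = (j * x' + z') * coord r 3"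
     "coord v 6 = (x + z) * coord r 6" "coord w 6 = (x' + z') * coord r 6"
    by (simp_all add: v w lookup_add p q r p3 p6 algebra_simps)
  show ?thesis
    unfolding coord_minor_def c by (simp add: algebra_simps)
qed

section \<open>Tameness and the final contradiction\<close>

definition tame_equivalent :: "rinf set \<Rightarrow> rinf set \<Rightarrow> bool" where
  "tame_equivalent V W \<longleftrightarrow> (\<forall>v\<in>V. \<exists>w\<in>W. \<forall>i. coord v i = 0 \<longleftrightarrow> coord w i = 0)"

text \<open>Both directions matter: \<open>VW\<close> realizes every von Staudt pattern in
  \<open>W\<close>, and \<open>WV\<close> excludes all other patterns.\<close>

lemma tame_equivalent_staudt_plane_cross_ratio:
  assumes W: "W \<in> grass_inf 3" and j: "0 < j" and e: "e \<noteq> 0"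
    and VW: "tame_equivalent (staudt_plane (2 * j + 6) (1 / real j) e) W"
    and WV: "tame_equivalent W (staudt_plane (2 * j + 6) (1 / real j) e)"
  shows "W \<in> cross_ratio_planes (real j)"
proof -
  let ?v = "staudt_vector (2 * j + 6) (1 / real j) e"
  have transfer: "staudt_zeros j w x y z" if "\<forall>i. coord (?v x y z) i = 0 \<longleftrightarrow> coord w i = 0" for w x y z
    using staudt_zeros_staudt_vector[OF j e, of x y z] that
    unfolding staudt_zeros_def by (simp del: coord_staudt_vector)
  have "subspace W" using W by (auto simp: grass_inf_def grass_def)
  moreover have "\<exists>x y z. staudt_zeros j w x y z \<and> (x = 0 \<and> y = 0 \<and> z = 0 \<longrightarrow> w = 0)" if w: "w \<in> W" for w
  proof -
    obtain x y z where xyz: "\<forall>i. coord w i = 0 \<longleftrightarrow> coord (?v x y z) i = 0"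
      using WV w unfolding tame_equivalent_def staudt_plane_def by blast
    \<comment> \<open>The patterns agree at all indices, including those beyond
      \<open>2 * j + 5\<close>, so every coordinate of \<open>w\<close> vanishes.\<close>
    have "w = 0" if "x = 0" "y = 0" "z = 0"
      by (rule poly_mapping_eqI) (use xyz that in \<open>simp add: staudt_form_def\<close>)
    then show ?thesis using transfer[of x y z w] xyz by auto
  qed
  moreover have "\<exists>w\<in>W. staudt_zeros j w x y z" for x y z
  proof -
    have "?v x y z \<in> staudt_plane (2 * j + 6) (1 / real j) e" by (auto simp: staudt_plane_def)
    then show ?thesis using VW transfer unfolding tame_equivalent_def by blast
  qed
  ultimately show ?thesis
    using von_staudt[of W j] W j by (auto simp: cross_ratio_planes_def)
qed

theorem mainTheorem1:
  shows "\<not> (\<exists>(K :: 'v set set) h. tame_triangulation 3 K h)"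
proof
  assume "\<exists>(K :: 'v set set) h. tame_triangulation 3 K h"
  then obtain K :: "'v set set" and h where "tame_triangulation 3 K h" by blast
  then have K: "abs_simplicial_complex K" and hom: "homeomorphic_map (realization_top K) (grass_inf_top 3) h"
    and tame: "\<And>\<sigma> x y. \<sigma> \<in> K \<Longrightarrow> x \<in> open_simplex \<sigma> \<Longrightarrow> y \<in> open_simplex \<sigma> \<Longrightarrow> tame_equivalent (h x) (h y)"
    by (auto simp: tame_triangulation_def triangulates_def tame_equivalent_def)
  obtain g where "homeomorphic_maps (realization_top K) (grass_inf_top 3) h g"
    using hom homeomorphic_map_maps by blast
  then have h: "continuous_map (realization_top K) (grass_inf_top 3) h"
    and g: "continuous_map (grass_inf_top 3) (realization_top K) g"
    and hg: "\<And>V. V \<in> grass_inf 3 \<Longrightarrow> h (g V) = V"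
    by (auto simp: homeomorphic_maps_def)
  have g_in: "g V \<in> topspace (realization_top K)" if "V \<in> grass_inf 3" for V
    using continuous_map_image_subset_topspace[OF g] that by auto
  have sub: "open_simplex \<sigma> \<subseteq> closed_simplex \<sigma>" for \<sigma> :: "'v set" by (auto simp: open_simplex_def)
  \<comment> \<open>The intended cross ratio is \<open>Suc n\<close>, shifted to be
    positive.\<close>
  define V where "V n = staudt_plane 7 (1 / real (Suc n)) 0" for n
  have carrier: "\<exists>\<sigma>\<in>K. g (V n) \<in> open_simplex \<sigma> \<and> h ` open_simplex \<sigma> \<subseteq> cross_ratio_planes (real (Suc n))" for n
  proof -
    let ?N = "2 * Suc n + 6" and ?c = "1 / real (Suc n)"
    \<comment> \<open>Nonzero values of \<open>e\<close> keep all forms visible, while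
      \<open>e\<close> tending to 0 makes the planes converge to \<open>V n\<close>.\<close>
    define x where "x m = g (staudt_plane ?N ?c (inverse (real (Suc m))))" for m
    have plane: "staudt_plane N c e \<in> grass_inf 3" if "5 \<le> N" for N c e
      using staudt_plane_in_grass_inf that .
    have "limitin (grass_inf_top 3) (\<lambda>m. staudt_plane ?N ?c (inverse (real (Suc m)))) (staudt_plane ?N ?c 0) sequentially"
      by (rule limitin_staudt_plane) (use LIMSEQ_inverse_real_of_nat in \<open>simp_all del: of_nat_Suc\<close>)
    from continuous_map_limit[OF g this]
    have "limitin (realization_top K) x (g (staudt_plane ?N ?c 0)) sequentially"
      unfolding comp_def x_def .
    moreover have "staudt_plane ?N ?c 0 = V n"
      unfolding V_def by (rule staudt_plane_truncate) simp
    ultimately have lim: "limitin (realization_top K) x (g (V n)) sequentially"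
      by simp
    have "x m \<in> topspace (realization_top K)" for m
      unfolding x_def by (rule g_in[OF plane]) simp
    then have "\<exists>\<tau>\<in>K. x m \<in> open_simplex \<tau>" for m
      using realization_carrier[OF K] by metis
    then obtain \<tau> where \<tau>: "\<And>m. \<tau> m \<in> K" "\<And>m. x m \<in> open_simplex (\<tau> m)" by metis
    \<comment> \<open>The limit is a point of the closed simplex of a single term, whose interior
      contains a plane with its full pattern.\<close>
    obtain m where m: "g (V n) \<in> closed_simplex (\<tau> m)"
      using limit_in_closed_simplex[OF K lim, of \<tau>] \<tau> sub by blast
    define C where "C = {y \<in> topspace (realization_top K). h y \<in> cross_ratio_planes (real (Suc n))}"
    have C: "closedin (realization_top K) C"
      unfolding C_def by (rule closedin_continuous_map_preimage[OF h closedin_cross_ratio_planes])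
    have "open_simplex (\<tau> m) \<subseteq> C"
    proof
      fix y assume y: "y \<in> open_simplex (\<tau> m)"
      then have top: "y \<in> topspace (realization_top K)" using \<tau>(1) sub by auto
      have hx: "h (x m) = staudt_plane ?N ?c (inverse (real (Suc m)))"
        unfolding x_def by (rule hg[OF plane]) simp
      have "h y \<in> cross_ratio_planes (real (Suc n))"
      proof (rule tame_equivalent_staudt_plane_cross_ratio)
        show "h y \<in> grass_inf 3" using continuous_map_image_subset_topspace[OF h] top by auto
        show "tame_equivalent (staudt_plane ?N ?c (inverse (real (Suc m)))) (h y)"
          "tame_equivalent (h y) (staudt_plane ?N ?c (inverse (real (Suc m))))"
          using tame[OF \<tau>(1)] \<tau>(2) y unfolding hx[symmetric] by blast+
      qed auto
      then show "y \<in> C" using top by (simp add: C_def)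
    qed
    then have cl: "closed_simplex (\<tau> m) \<subseteq> C"
      by (rule closed_simplex_subset_closedin[OF K \<tau>(1) C _ \<tau>(2)])
    obtain \<sigma> where \<sigma>: "\<sigma> \<in> K" "\<sigma> \<subseteq> \<tau> m" "g (V n) \<in> open_simplex \<sigma>"
      using closed_simplex_carrier[OF K \<tau>(1) m] .
    have "open_simplex \<sigma> \<subseteq> C"
      using sub closed_simplex_mono[OF \<sigma>(2) abs_simplicial_complexD(1)[OF K \<tau>(1)]] cl by blast
    then show ?thesis using \<sigma> by (auto simp: C_def)
  qed
  then obtain \<sigma> where \<sigma>: "\<And>n. \<sigma> n \<in> K" "\<And>n. g (V n) \<in> open_simplex (\<sigma> n)"
    "\<And>n. h ` open_simplex (\<sigma> n) \<subseteq> cross_ratio_planes (real (Suc n))"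
    by metis
  have "(\<lambda>n. 1 / real (Suc n)) \<longlonglongrightarrow> 0"
    using LIMSEQ_inverse_real_of_nat by (simp add: inverse_eq_divide)
  \<comment> \<open>At \<open>c = 0\<close> form 3 becomes form 0 and the cross ratio degenerates,
    but the plane is still three-dimensional.\<close>
  then have "limitin (grass_inf_top 3) V (staudt_plane 7 0 0) sequentially"
    unfolding V_def by (intro limitin_staudt_plane) auto
  from continuous_map_limit[OF g this]
  have "limitin (realization_top K) (\<lambda>n. g (V n)) (g (staudt_plane 7 0 0)) sequentially"
    by (simp only: comp_def)
  then obtain m n where "m \<noteq> n" "\<sigma> m = \<sigma> n"
    using convergent_sequence_repeats_open_simplex[OF K, of "\<lambda>n. g (V n)" _ \<sigma>] \<sigma> by blast
  then have "h (g (V n)) \<in> cross_ratio_planes (real (Suc m))"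
    using \<sigma>(2)[of n] \<sigma>(3)[of m] by auto
  moreover have "h (g (V n)) = V n"
    by (rule hg) (simp add: V_def staudt_plane_in_grass_inf)
  \<comment> \<open>A shared open simplex gives \<open>V n\<close> the cross ratio
    \<open>Suc m\<close> besides its own \<open>Suc n\<close>.\<close>
  ultimately have "real (Suc m) = real (Suc n)"
    using staudt_plane_cross_ratio[of "real (Suc n)" 0 "real (Suc m)"] by (simp add: V_def)
  then show False using \<open>m \<noteq> n\<close> by simp
qed

end
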